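(* Let $\mathbb{D}$ be the open unit disk in $\mathbb{C}$. Let $\widetilde{E}\subset\mathbb{D}$ be a closed set with $0\notin\widetilde{E}$, and suppose there exists a constant $y>0$ such that $|z|\geq y$ for every $z\in\widetilde{E}$. Assume furthermore that $\Omega=\mathbb{D}\setminus\widetilde{E}$ is doubly connected. If $g$ is a conformal map of $A_r$ onto $\Omega$, for some $r\in(0,1)$, such that $g$ maps $\partial\mathbb{D}$ onto $\partial\mathbb{D}$, then \[ |g^{-1}(0)|\geq y. \]
   Context: $A_r=\{z\in\mathbb{C}:r<|z|<1\}$ for $0<r<1$. A conformal map of a domain onto another is a biholomorphism between them. The condition that $g$ maps $\partial\mathbb{D}$ onto $\partial\mathbb{D}$ is understood in the sense of boundary correspondence: $|g(z)|\to1$ as $|z|\to1$, $z\in A_r$. *)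

theory Defs
  imports "HOL-Complex_Analysis.Complex_Analysis"
begin

definition annulus :: "real \<Rightarrow> complex set" where
  "annulus r = {z. r < cmod z \<and> cmod z < 1}"

(* The Riemann sphere is the one-point compactification of the plane: its points are Some z for
   complex z, and None for infinity. *)
abbreviation riemann_sphere :: "complex option topology" where
  "riemann_sphere \<equiv> Alexandroff_compactification euclidean"

definition doubly_connected :: "complex set \<Rightarrow> bool" where
  "doubly_connected S \<longleftrightarrow> open S \<and> connected S \<and> S \<noteq> {} \<and>
     card (connected_components_of (subtopology riemann_sphere (- Some ` S))) = 2"

definition conformal_map_onto :: "(complex \<Rightarrow> complex) \<Rightarrow> complex set \<Rightarrow> complex set \<Rightarrow> bool" where
  "conformal_map_onto g S T \<longleftrightarrow>
     g holomorphic_on S \<and> bij_betw g S T \<and> inv_into S g holomorphic_on T"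

(* The map g of annulus r maps the unit circle onto itself in the sense of boundary correspondence:
   cmod (g z) tends to 1 as cmod z tends to 1 within the annulus. *)
definition maps_unit_circle_to_itself :: "(complex \<Rightarrow> complex) \<Rightarrow> real \<Rightarrow> bool" where
  "maps_unit_circle_to_itself g r \<longleftrightarrow>
     ((\<lambda>z. cmod (g z)) \<longlongrightarrow> 1) (inf (filtercomap cmod (nhds 1)) (principal (annulus r)))"

end

theory Submission
  imports Defs
begin

text \<open>
  Let \<open>a\<close> be the point of the annulus with \<open>g a = 0\<close>, and let \<open>M \<rho>\<close> be the mean of
  \<open>ln (cmod (g z))\<close> over the circle \<open>cmod z = \<rho>\<close>. The point of the proof is a version of Jensen's
  formula in the annulus. As \<open>a\<close> is the only zero of \<open>g\<close> and is simple, \<open>g z = (z - a) * k z\<close> with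
  \<open>k\<close> holomorphic and free of zeros. The mean of \<open>ln (cmod (k z))\<close> is \<open>n * ln \<rho> + c\<close>, where the
  integer \<open>n\<close> is the winding number about 0 of the image under \<open>k\<close> of a circle around 0, and the
  mean of \<open>ln (cmod (z - a))\<close> is \<open>ln (max \<rho> (cmod a))\<close>. Hence
  \<open>M \<rho> = n * ln \<rho> + c + ln (max \<rho> (cmod a))\<close>: this is
  \<open>circle_mean_ln_norm_simple_zero\<close>.

  The two boundary circles determine enough of the constants. Near the outer circle
  \<open>M \<rho> = (n + 1) * ln \<rho> + c\<close>, and \<open>M \<rho>\<close> tends to 0 because \<open>cmod (g z)\<close> tends to 1; so \<open>c = 0\<close>. Since
  \<open>cmod (g z) < 1\<close> on each circle, \<open>(n + 1) * ln \<rho> < 0\<close>, so \<open>n + 1 > 0\<close> and, \<open>n\<close> being an integer,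
  \<open>n \<ge> 0\<close>. Near the inner circle \<open>M \<rho> = n * ln \<rho> + ln (cmod a) \<le> ln (cmod a)\<close>. On the other hand
  \<open>g\<close> is proper, so for \<open>\<rho>\<close> close to \<open>r\<close> the image of the circle avoids any given compact disc
  \<open>cball 0 s\<close> inside the range, that is, \<open>M \<rho> \<ge> ln s\<close>. Thus \<open>cmod a \<ge> s\<close> for every
  \<open>s < min y 1\<close>. Letting \<open>s\<close> tend to \<open>min y 1\<close> and using \<open>cmod a < 1\<close> gives \<open>cmod a \<ge> y\<close>.
\<close>

section \<open>Means over circles\<close>

lemma has_integral_Re:
  fixes f :: "real \<Rightarrow> complex"
  assumes "(f has_integral I) S"
  shows "((\<lambda>t. Re (f t)) has_integral Re I) S"
  using has_integral_linear[OF assms bounded_linear_Re] by (simp add: o_def)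

lemma circle_mean_ge:
  assumes "(f has_integral 2 * pi * m) {0..2*pi}" "\<And>t. b \<le> f t"
  shows "b \<le> m"
proof -
  have "((\<lambda>t. b) has_integral 2 * pi * b) {0..2*pi}"
    using has_integral_const_real[of b 0 "2*pi"] by simp
  from has_integral_le[OF this assms(1)] assms(2) show ?thesis by simp
qed

lemma circle_mean_le:
  assumes "(f has_integral 2 * pi * m) {0..2*pi}" "\<And>t. f t \<le> b"
  shows "m \<le> b"
  using circle_mean_ge[of "\<lambda>t. - f t" "-m" "-b"] has_integral_neg[OF assms(1)] assms(2) by simp

lemma circle_mean_holomorphic:
  fixes f :: "complex \<Rightarrow> complex"
  assumes "continuous_on (cball 0 \<rho>) f" "f holomorphic_on ball 0 \<rho>" "0 < \<rho>"
  shows "((\<lambda>t. f (of_real \<rho> * cis t)) has_integral 2 * pi * f 0) {0..2*pi}"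
proof -
  have "((\<lambda>u. f u / (u - 0)) has_contour_integral (2 * of_real pi * \<i> * f 0)) (circlepath 0 \<rho>)"
    using assms by (intro Cauchy_integral_circlepath) auto
  then have "((\<lambda>t. f (0 + \<rho> * cis t) / (0 + \<rho> * cis t - 0) * \<rho> * \<i> * cis t)
      has_integral (2 * of_real pi * \<i> * f 0)) {0..2*pi}"
    unfolding circlepath_def using has_contour_integral_part_circlepath_iff[of 0 "2*pi"] by simp
  then have "((\<lambda>t. \<i> * f (\<rho> * cis t)) has_integral (\<i> * (2 * of_real pi * f 0))) {0..2*pi}"
    using \<open>0 < \<rho>\<close> by (simp add: field_simps)
  from has_integral_mult_right[OF this, of "-\<i>"] show ?thesis
    by (simp add: algebra_simps)
qed

section \<open>Jensen's formula for a single linear factor\<close>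

text \<open>
  On the disc in question \<open>1 - b * z\<close> has positive real part, so its logarithm is holomorphic there
  and vanishes at 0; the mean value property applies to the real part.
\<close>
lemma circle_mean_ln_norm_one_minus:
  fixes b :: complex
  assumes "0 < \<rho>" "cmod b * \<rho> < 1"
  shows "((\<lambda>t. ln (cmod (1 - b * (of_real \<rho> * cis t)))) has_integral 0) {0..2*pi}"
proof -
  have pos: "Re (1 - b * z) > 0" if "z \<in> cball 0 \<rho>" for z
  proof -
    have "Re (b * z) \<le> cmod b * cmod z"
      using complex_Re_le_cmod[of "b * z"] by (simp add: norm_mult)
    also have "\<dots> \<le> cmod b * \<rho>"
      using that by (intro mult_left_mono) auto
    finally show ?thesis using assms by simp
  qed
  have nonpos: "1 - b * z \<notin> \<real>\<^sub>\<le>\<^sub>0" if "z \<in> cball 0 \<rho>" for z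
    using pos[OF that] by (auto simp: complex_nonpos_Reals_iff)
  have "(\<lambda>z. Ln (1 - b * z)) holomorphic_on cball 0 \<rho>"
    using nonpos by (intro holomorphic_intros) auto
  then have "((\<lambda>t. Ln (1 - b * (of_real \<rho> * cis t))) has_integral 2 * pi * Ln (1 - b * 0)) {0..2*pi}"
    using assms by (intro circle_mean_holomorphic)
      (auto intro: holomorphic_on_imp_continuous_on holomorphic_on_subset[OF _ ball_subset_cball])
  from has_integral_Re[OF this]
  have "((\<lambda>t. Re (Ln (1 - b * (of_real \<rho> * cis t)))) has_integral 0) {0..2*pi}"
    by simp
  moreover have "Re (Ln (1 - b * (of_real \<rho> * cis t))) = ln (cmod (1 - b * (of_real \<rho> * cis t)))" for t
  proof (rule Re_Ln)
    have "of_real \<rho> * cis t \<in> cball 0 \<rho>" using assms by (simp add: norm_mult)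
    from pos[OF this] show "1 - b * (of_real \<rho> * cis t) \<noteq> 0" by force
  qed
  ultimately show ?thesis by simp
qed

text \<open>
  In both cases \<open>cmod (z - a)\<close> is, on the circle, a constant \<open>m\<close> times \<open>cmod (1 - b * z)\<close> with
  \<open>1 - b * z\<close> free of zeros on the closed disc. For \<open>\<rho> < cmod a\<close> one takes out the factor \<open>a\<close>. For
  \<open>\<rho> > cmod a\<close> the zero \<open>a\<close> lies inside the circle and is reflected to \<open>\<rho>^2 / cnj a\<close>, outside it,
  which changes the modulus on the circle by a constant factor only.
\<close>
lemma circle_mean_ln_dist:
  fixes a :: complex
  assumes "0 < \<rho>" "a \<noteq> 0" "\<rho> \<noteq> cmod a"
  shows "((\<lambda>t. ln (cmod (of_real \<rho> * cis t - a))) has_integral 2 * pi * ln (max \<rho> (cmod a))) {0..2*pi}"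
proof -
  have split: "((\<lambda>t. ln (cmod (of_real \<rho> * cis t - a))) has_integral 2 * pi * ln m) {0..2*pi}"
    if "0 < m" "cmod b * \<rho> < 1"
      and eq: "\<And>t. cmod (of_real \<rho> * cis t - a) = m * cmod (1 - b * (of_real \<rho> * cis t))"
    for m b
  proof -
    have "((\<lambda>t. ln m + ln (cmod (1 - b * (of_real \<rho> * cis t)))) has_integral (2*pi*ln m + 0)) {0..2*pi}"
      using that assms has_integral_const_real[of "ln m" 0 "2*pi"]
      by (intro has_integral_add circle_mean_ln_norm_one_minus) auto
    moreover have "1 - b * (of_real \<rho> * cis t) \<noteq> 0" for t
    proof
      assume "1 - b * (of_real \<rho> * cis t) = 0"
      then have "cmod (b * (of_real \<rho> * cis t)) = 1" by simp
      then show False using that assms by (simp add: norm_mult)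
    qed
    ultimately show ?thesis
      using \<open>0 < m\<close> by (simp add: eq ln_mult_pos)
  qed
  show ?thesis
  proof (cases "\<rho> < cmod a")
    case True
    have "cmod (of_real \<rho> * cis t - a) = cmod a * cmod (1 - inverse a * (of_real \<rho> * cis t))" for t
    proof -
      have "a * (1 - inverse a * (of_real \<rho> * cis t)) = a - of_real \<rho> * cis t"
        using \<open>a \<noteq> 0\<close> by (simp add: field_simps)
      then show ?thesis by (metis norm_mult norm_minus_commute)
    qed
    moreover have "cmod (inverse a) * \<rho> < 1"
      using True assms by (simp add: norm_inverse inverse_eq_divide norm_divide field_simps)
    ultimately have "((\<lambda>t. ln (cmod (of_real \<rho> * cis t - a))) has_integral 2 * pi * ln (cmod a)) {0..2*pi}"
      using assms(2) by (intro split[of "cmod a" "inverse a"]) simp_all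
    then show ?thesis using True by (simp add: max_def)
  next
    case False
    have "cmod (of_real \<rho> * cis t - a) = \<rho> * cmod (1 - cnj a / \<rho>^2 * (of_real \<rho> * cis t))" for t
    proof -
      define u where "u = cis t"
      have u: "u * cnj u = 1" by (simp add: u_def cis_cnj cis_mult)
      have "of_real \<rho> * u - a = of_real \<rho> * u * cnj (1 - cnj a / \<rho>^2 * (of_real \<rho> * u))"
      proof -
        have "of_real \<rho> * u * cnj (1 - cnj a / \<rho>^2 * (of_real \<rho> * u)) = of_real \<rho> * u - a * (u * cnj u)"
          using assms(1) by (simp add: right_diff_distrib power2_eq_square)
        then show ?thesis by (simp add: u)
      qed
      then have "cmod (of_real \<rho> * u - a) = cmod (of_real \<rho> * u) * cmod (1 - cnj a / \<rho>^2 * (of_real \<rho> * u))"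
        by (metis norm_mult complex_mod_cnj)
      then show ?thesis using assms(1) by (simp add: norm_mult u_def)
    qed
    moreover have "cmod (cnj a / \<rho>^2) * \<rho> < 1"
      using False assms by (simp add: norm_divide norm_mult power2_eq_square field_simps)
    ultimately have "((\<lambda>t. ln (cmod (of_real \<rho> * cis t - a))) has_integral 2 * pi * ln \<rho>) {0..2*pi}"
      using assms(1) by (intro split[of \<rho> "cnj a / \<rho>^2"])
    then show ?thesis using False by (simp add: max_def)
  qed
qed

section \<open>Jensen's formula in an annulus\<close>

text \<open>
  Under \<open>z = exp w\<close> the annulus is covered by the vertical strip \<open>S\<close>, which is convex, so
  \<open>k (exp w) = exp (Q w)\<close> with \<open>Q\<close> holomorphic on \<open>S\<close>, and \<open>ln (cmod (k z)) = Re (Q w)\<close>. The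
  function \<open>k\<close> itself need not have a logarithm on the annulus: going once around adds
  \<open>2 * pi * \<i> * n\<close> to \<open>Q\<close>, with a constant integer \<open>n\<close>, the winding number. If \<open>F\<close> is a primitive of
  \<open>Q\<close>, the integral over the circle is, up to the factor \<open>- \<i>\<close>, the increment
  \<open>F (w + 2 * pi * \<i>) - F w\<close>, whose derivative in \<open>w\<close> is this constant. So it is an affine function
  of \<open>Re w = ln \<rho>\<close>.
\<close>
lemma circle_mean_ln_norm_annulus:
  fixes k :: "complex \<Rightarrow> complex"
  assumes "0 < r" and hol: "k holomorphic_on annulus r" and nz: "\<And>z. z \<in> annulus r \<Longrightarrow> k z \<noteq> 0"
  obtains n :: int and c :: real where
    "\<And>\<rho>. r < \<rho> \<Longrightarrow> \<rho> < 1 \<Longrightarrow>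
       ((\<lambda>t. ln (cmod (k (of_real \<rho> * cis t)))) has_integral 2 * pi * (n * ln \<rho> + c)) {0..2*pi}"
proof (cases "r < 1")
  case False
  with that show ?thesis by fastforce
next
  case True
  define S where "S = {w. ln r < Re w} \<inter> {w. Re w < 0}"
  have S: "open S" "convex S"
    unfolding S_def by (auto intro: open_halfspace_Re_gt open_halfspace_Re_lt
        convex_Int convex_halfspace_Re_gt convex_halfspace_Re_lt)
  have exp_S: "exp w \<in> annulus r" if "w \<in> S" for w
    using that \<open>0 < r\<close> exp_less_cancel_iff[of "ln r" "Re w"] by (simp add: S_def annulus_def)
  have shift_S: "w + of_real (2*pi) * \<i> \<in> S" if "w \<in> S" for w
    using that by (simp add: S_def)
  have "k \<circ> exp holomorphic_on S"
    by (rule holomorphic_on_compose_gen[OF _ hol]) (auto intro: holomorphic_intros exp_S)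
  then obtain Q where Q: "Q holomorphic_on S" "\<And>w. w \<in> S \<Longrightarrow> k (exp w) = exp (Q w)"
    using contractible_imp_holomorphic_log[OF _ convex_imp_contractible[OF S(2)], of "k \<circ> exp"] nz exp_S
    by (metis comp_apply)
  obtain F where "\<And>w. w \<in> S \<Longrightarrow> (F has_field_derivative Q w) (at w within S)"
    using holomorphic_convex_primitive'[OF S(2,1) Q(1)] by blast
  then have F: "(F has_field_derivative Q w) (at w)" if "w \<in> S" for w
    using that S at_within_open by metis
  define D where "D = (\<lambda>w. Q (w + of_real (2*pi) * \<i>) - Q w)"
  have expD: "exp (D w) = 1" if "w \<in> S" for w
  proof -
    have "exp (w + of_real (2*pi) * \<i>) = exp w"
      using exp_plus_2pin[of w 1] by (simp add: mult_ac)
    then have "exp (Q (w + of_real (2*pi) * \<i>)) = exp (Q w)"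
      using Q(2)[OF that] Q(2)[OF shift_S[OF that]] by simp
    then show ?thesis by (simp add: D_def exp_diff)
  qed
  have holD: "D holomorphic_on S"
  proof -
    have "Q \<circ> (\<lambda>w. w + of_real (2*pi) * \<i>) holomorphic_on S"
    proof (rule holomorphic_on_compose_gen[OF _ Q(1)])
      show "(\<lambda>w. w + of_real (2*pi) * \<i>) ` S \<subseteq> S" using shift_S by blast
    qed (intro holomorphic_intros)
    with Q(1) show ?thesis unfolding D_def o_def by (simp add: holomorphic_on_diff)
  qed
  \<comment> \<open>\<open>D\<close> takes values in the discrete set of periods of \<open>exp\<close>, so it is constant: differentiate
    \<open>exp (D w) = 1\<close>.\<close>
  have "(D has_field_derivative 0) (at w within S)" if "w \<in> S" for w
  proof -
    have d: "(D has_field_derivative deriv D w) (at w)"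
      using holD S(1) that by (rule holomorphic_derivI)
    have "((\<lambda>w. exp (D w)) has_field_derivative exp (D w) * deriv D w) (at w)"
      by (rule derivative_eq_intros d refl)+
    moreover have "((\<lambda>w. exp (D w)) has_field_derivative 0) (at w)"
      by (rule has_field_derivative_transform_within_open[of "\<lambda>_. 1" _ _ S]) (use S that expD in auto)
    ultimately have "deriv D w = 0" by (metis DERIV_unique exp_not_eq_zero mult_eq_0_iff)
    with d show ?thesis by (simp add: has_field_derivative_at_within)
  qed
  then obtain d where d: "\<And>w. w \<in> S \<Longrightarrow> D w = d"
    using has_field_derivative_zero_constant[OF S(2)] by metis
  have neS: "of_real (ln r / 2) \<in> S"
    using \<open>0 < r\<close> True by (simp add: S_def ln_less_zero field_simps)
  then have "exp d = 1" using expD d by metis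
  then obtain n :: int where "Re d = 0" "Im d = of_int (2 * n) * pi"
    unfolding exp_eq_1 by blast
  then have n: "d = of_real (2 * pi * n) * \<i>"
    by (simp add: complex_eq_iff)
  define H where "H = (\<lambda>w. F (w + of_real (2*pi) * \<i>) - F w - d * w)"
  have "(H has_field_derivative 0) (at w within S)" if "w \<in> S" for w
  proof -
    have "((\<lambda>w. F (w + of_real (2*pi) * \<i>)) has_field_derivative Q (w + of_real (2*pi) * \<i>)) (at w)"
      using F[OF shift_S[OF that]] by (simp add: DERIV_shift)
    from DERIV_diff[OF DERIV_diff[OF this F[OF that]] DERIV_cmult[OF DERIV_ident, of d]]
    have "(H has_field_derivative (D w - d)) (at w)"
      by (simp add: H_def D_def)
    with d[OF that] show ?thesis by (simp add: has_field_derivative_at_within)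
  qed
  then obtain C where C: "\<And>w. w \<in> S \<Longrightarrow> H w = C"
    using has_field_derivative_zero_constant[OF S(2)] by metis
  show ?thesis
  proof (rule that[of n "Im C / (2*pi)"])
    fix \<rho> assume \<rho>: "r < \<rho>" "\<rho> < 1"
    define x where "x = ln \<rho>"
    have xS: "of_real x + \<i> * of_real t \<in> S" for t
      using \<rho> \<open>0 < r\<close> by (simp add: S_def x_def)
    have x: "exp (of_real x + \<i> * of_real t) = of_real \<rho> * cis t" for t
      using \<rho> \<open>0 < r\<close> by (simp add: x_def exp_add cis_conv_exp exp_of_real)
    have "((\<lambda>t. -\<i> * F (of_real x + \<i> * of_real t)) has_vector_derivative Q (of_real x + \<i> * of_real t))
        (at t within {0..2*pi})" for t
    proof -
      have "((\<lambda>t. of_real x + \<i> * of_real t) has_vector_derivative \<i>) (at t within {0..2*pi})"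
        by (auto intro!: derivative_eq_intros simp: has_vector_derivative_def fun_eq_iff scaleR_conv_of_real)
      from field_vector_diff_chain_within[OF this, of F]
      have "((\<lambda>t. F (of_real x + \<i> * of_real t)) has_vector_derivative \<i> * Q (of_real x + \<i> * of_real t))
          (at t within {0..2*pi})"
        using F[OF xS] by (simp add: o_def has_field_derivative_at_within)
      from has_vector_derivative_mult_right[OF this, of "-\<i>"] show ?thesis by simp
    qed
    then have "((\<lambda>t. Q (of_real x + \<i> * of_real t)) has_integral
        (-\<i> * F (of_real x + \<i> * of_real (2*pi)) - (-\<i> * F (of_real x + \<i> * of_real 0)))) {0..2*pi}"
      by (intro fundamental_theorem_of_calculus) auto
    moreover have "-\<i> * F (of_real x + \<i> * of_real (2*pi)) - (-\<i> * F (of_real x + \<i> * of_real 0))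
        = -\<i> * (C + d * x)"
      using C[OF xS[of 0]] by (simp add: H_def algebra_simps)
    ultimately have "((\<lambda>t. Re (Q (of_real x + \<i> * of_real t))) has_integral Re (-\<i> * (C + d * x))) {0..2*pi}"
      using has_integral_Re by metis
    moreover have "Re (Q (of_real x + \<i> * of_real t)) = ln (cmod (k (of_real \<rho> * cis t)))" for t
      using Q(2)[OF xS[of t]] x[of t] by simp
    ultimately show "((\<lambda>t. ln (cmod (k (of_real \<rho> * cis t)))) has_integral
        2 * pi * (n * ln \<rho> + Im C / (2*pi))) {0..2*pi}"
      by (simp add: n x_def algebra_simps)
  qed
qed

text \<open>
  A radius equal to \<open>cmod a\<close> is excluded since the integrand is singular on that circle; the other
  radii suffice, because only circles close to the two boundary circles matter later.
\<close>
lemma circle_mean_ln_norm_simple_zero: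
  fixes g :: "complex \<Rightarrow> complex"
  assumes "0 < r" and hol: "g holomorphic_on annulus r" and inj: "inj_on g (annulus r)"
    and a: "a \<in> annulus r" "g a = 0"
  obtains n :: int and c :: real where
    "\<And>\<rho>. r < \<rho> \<Longrightarrow> \<rho> < 1 \<Longrightarrow> \<rho> \<noteq> cmod a \<Longrightarrow>
       ((\<lambda>t. ln (cmod (g (of_real \<rho> * cis t)))) has_integral
         2 * pi * (n * ln \<rho> + c + ln (max \<rho> (cmod a)))) {0..2*pi}"
proof -
  have op: "open (annulus r)"
    unfolding annulus_def by (intro open_Collect_conj open_Collect_less continuous_intros)
  define k where "k = (\<lambda>z. if z = a then deriv g a else g z / (z - a))"
  have "k holomorphic_on annulus r"
    using pole_lemma_open[OF hol op, of a] unfolding k_def a(2) by (simp only: diff_zero)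
  moreover have "k z \<noteq> 0" if "z \<in> annulus r" for z
  proof (cases "z = a")
    case True
    then show ?thesis using holomorphic_injective_imp_regular[OF hol op inj a(1)] by (simp add: k_def)
  next
    case False
    then have "g z \<noteq> 0" using inj_on_eq_iff[OF inj that a(1)] a(2) by simp
    with False show ?thesis by (simp add: k_def)
  qed
  ultimately obtain n :: int and c :: real where k:
    "\<And>\<rho>. r < \<rho> \<Longrightarrow> \<rho> < 1 \<Longrightarrow>
       ((\<lambda>t. ln (cmod (k (of_real \<rho> * cis t)))) has_integral 2 * pi * (n * ln \<rho> + c)) {0..2*pi}"
    using circle_mean_ln_norm_annulus[OF \<open>0 < r\<close>] by blast
  show ?thesis
  proof (rule that)
    fix \<rho> assume \<rho>: "r < \<rho>" "\<rho> < 1" "\<rho> \<noteq> cmod a"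
    have "ln (cmod (k (of_real \<rho> * cis t))) + ln (cmod (of_real \<rho> * cis t - a))
        = ln (cmod (g (of_real \<rho> * cis t)))" for t
    proof -
      let ?z = "of_real \<rho> * cis t"
      have nrm: "cmod ?z = \<rho>" using \<rho> \<open>0 < r\<close> by (simp add: norm_mult)
      then have "?z \<in> annulus r" "?z \<noteq> a" using \<rho> by (auto simp: annulus_def)
      then have "g ?z \<noteq> 0" using a inj by (metis inj_onD)
      with \<open>?z \<noteq> a\<close> show ?thesis by (simp add: k_def norm_divide ln_div)
    qed
    moreover have "((\<lambda>t. ln (cmod (k (of_real \<rho> * cis t))) + ln (cmod (of_real \<rho> * cis t - a)))
        has_integral (2 * pi * (n * ln \<rho> + c) + 2 * pi * ln (max \<rho> (cmod a)))) {0..2*pi}"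
      using \<rho> \<open>0 < r\<close> a by (intro has_integral_add k circle_mean_ln_dist) (auto simp: annulus_def)
    ultimately show "((\<lambda>t. ln (cmod (g (of_real \<rho> * cis t)))) has_integral
         2 * pi * (n * ln \<rho> + c + ln (max \<rho> (cmod a)))) {0..2*pi}"
      by (simp add: algebra_simps)
  qed
qed

section \<open>Boundary behaviour of the map\<close>

lemma norm_lower_bound_of_maps_unit_circle:
  assumes "maps_unit_circle_to_itself g r" "s < 1"
  obtains q where "q < 1" "\<And>z. z \<in> annulus r \<Longrightarrow> q < cmod z \<Longrightarrow> s < cmod (g z)"
proof -
  have "eventually (\<lambda>z. s < cmod (g z)) (inf (filtercomap cmod (nhds 1)) (principal (annulus r)))"
    using assms unfolding maps_unit_circle_to_itself_def by (rule order_tendstoD)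
  then obtain U where U: "open U" "1 \<in> U" "\<And>z. cmod z \<in> U \<Longrightarrow> z \<in> annulus r \<Longrightarrow> s < cmod (g z)"
    by (auto simp: eventually_inf_principal eventually_filtercomap_nhds)
  then obtain e where "e > 0" "ball 1 e \<subseteq> U" by (meson openE)
  with U show ?thesis
    by (intro that[of "1 - e"]) (auto simp: annulus_def dist_real_def subset_iff)
qed

text \<open>
  The preimage of a compact disc inside the range is compact, hence keeps a positive distance from
  the inner circle.
\<close>
lemma norm_lower_bound_near_inner_circle:
  assumes g: "conformal_map_onto g (annulus r) T" and "cball 0 s \<subseteq> T" "0 \<le> r" "r < 1"
  obtains q where "r < q" "q < 1" "\<And>z. z \<in> annulus r \<Longrightarrow> cmod z < q \<Longrightarrow> s < cmod (g z)"
proof -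
  let ?h = "inv_into (annulus r) g"
  \<comment> \<open>The extra point makes the set nonempty also when \<open>s < 0\<close>.\<close>
  let ?K = "insert (of_real ((1 + r) / 2)) (?h ` cball 0 s)"
  have bij: "bij_betw g (annulus r) T" and h: "?h holomorphic_on T"
    using g by (auto simp: conformal_map_onto_def)
  have hK: "?h w \<in> annulus r" if "cmod w \<le> s" for w
    using that assms(2) bij_betwE[OF bij_betw_inv_into[OF bij]] by auto
  have "compact ?K"
    using h assms(2)
    by (intro compact_insert compact_continuous_image holomorphic_on_imp_continuous_on)
      (auto intro: holomorphic_on_subset)
  then obtain z0 where z0: "z0 \<in> ?K" "\<And>z. z \<in> ?K \<Longrightarrow> cmod z0 \<le> cmod z"
    using continuous_attains_inf[of ?K cmod] continuous_on_norm_id by blast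
  show ?thesis
  proof (rule that[of "cmod z0"])
    have "cmod (of_real ((1 + r) / 2)) = (1 + r) / 2"
      unfolding norm_of_real using \<open>0 \<le> r\<close> by simp
    then have "of_real ((1 + r) / 2) \<in> annulus r"
      unfolding annulus_def using \<open>r < 1\<close> by simp
    then have "z0 \<in> annulus r"
      using z0(1) hK by (auto simp del: of_real_divide of_real_add)
    then show "r < cmod z0" "cmod z0 < 1" by (auto simp: annulus_def)
    fix z assume z: "z \<in> annulus r" "cmod z < cmod z0"
    show "s < cmod (g z)"
    proof (rule ccontr)
      assume "\<not> s < cmod (g z)"
      then have "?h (g z) \<in> ?K" by simp
      then have "z \<in> ?K" using bij z(1) by (simp add: bij_betw_inv_into_left)
      with z0(2) z(2) show False by fastforce
    qed
  qed
qed

section \<open>The bound for the preimage of 0\<close>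

theorem theorem1p2:
  fixes E :: "complex set" and y r :: real and g :: "complex \<Rightarrow> complex"
  assumes "closedin (top_of_set (ball 0 1)) E"
    and "0 \<notin> E"
    and "y > 0"
    and "\<And>z. z \<in> E \<Longrightarrow> cmod z \<ge> y"
    and "doubly_connected (ball 0 1 - E)"
    and "0 < r" and "r < 1"
    and "conformal_map_onto g (annulus r) (ball 0 1 - E)"
    and "maps_unit_circle_to_itself g r"
  shows "cmod (inv_into (annulus r) g 0) \<ge> y"
proof -
  define a where "a = inv_into (annulus r) g 0"
  have hol: "g holomorphic_on annulus r" and bij: "bij_betw g (annulus r) (ball 0 1 - E)"
    using assms by (auto simp: conformal_map_onto_def)
  have "0 \<in> ball 0 1 - E" using assms by auto
  then have a: "a \<in> annulus r" "g a = 0"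
    using bij unfolding a_def by (auto simp: bij_betw_def inv_into_into f_inv_into_f)
  have inj: "inj_on g (annulus r)" using bij by (simp add: bij_betw_def)
  have a_bounds: "r < cmod a" "cmod a < 1" using a by (auto simp: annulus_def)
  have on_circle: "of_real \<rho> * cis t \<in> annulus r" "cmod (of_real \<rho> * cis t) = \<rho>"
    if "r < \<rho>" "\<rho> < 1" for \<rho> t
    using that \<open>0 < r\<close> by (auto simp: annulus_def norm_mult)
  have g_lt1: "cmod (g z) < 1" if "z \<in> annulus r" for z
    using bij_betwE[OF bij] that by auto
  have g_pos: "0 < cmod (g z)" if "z \<in> annulus r" "cmod z \<noteq> cmod a" for z
    using that a inj by (metis inj_onD zero_less_norm_iff)
  obtain n :: int and c :: real where mean:
    "\<And>\<rho>. r < \<rho> \<Longrightarrow> \<rho> < 1 \<Longrightarrow> \<rho> \<noteq> cmod a \<Longrightarrow>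
       ((\<lambda>t. ln (cmod (g (of_real \<rho> * cis t)))) has_integral
         2 * pi * (n * ln \<rho> + c + ln (max \<rho> (cmod a)))) {0..2*pi}"
    using circle_mean_ln_norm_simple_zero[OF \<open>0 < r\<close> hol inj a] by blast
  have outer: "((\<lambda>t. ln (cmod (g (of_real \<rho> * cis t)))) has_integral
         2 * pi * ((n + 1) * ln \<rho> + c)) {0..2*pi}" if "cmod a < \<rho>" "\<rho> < 1" for \<rho>
    using mean[of \<rho>] that a_bounds by (simp add: max_def algebra_simps)
  have lim: "((\<lambda>\<rho>. (n + 1) * ln \<rho> + c) \<longlongrightarrow> c) (at_left 1)"
    by (auto intro!: tendsto_eq_intros)
  have ev: "eventually (\<lambda>\<rho>. q < \<rho> \<and> cmod a < \<rho> \<and> \<rho> < 1) (at_left 1)" if "q < 1" for q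
    using that a_bounds by (intro eventually_at_leftI[of "max q (cmod a)"]) auto
  have "c \<le> 0"
  proof (rule tendsto_upperbound[OF lim])
    show "\<forall>\<^sub>F \<rho> in at_left 1. (n + 1) * ln \<rho> + c \<le> 0"
      using ev[OF \<open>r < 1\<close>]
    proof eventually_elim
      case (elim \<rho>)
      show ?case
        using elim g_lt1[OF on_circle(1)] g_pos[OF on_circle(1)] on_circle(2)
        by (intro circle_mean_le[OF outer]) (auto simp: less_imp_le)
    qed
  qed simp
  have "ln s \<le> c" if "0 < s" "s < 1" for s
  proof -
    obtain q where q: "q < 1" "\<And>z. z \<in> annulus r \<Longrightarrow> q < cmod z \<Longrightarrow> s < cmod (g z)"
      using norm_lower_bound_of_maps_unit_circle assms(9) \<open>s < 1\<close> by blast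
    show ?thesis
    proof (rule tendsto_lowerbound[OF lim])
      show "\<forall>\<^sub>F \<rho> in at_left 1. ln s \<le> (n + 1) * ln \<rho> + c"
        using ev[OF \<open>q < 1\<close>]
      proof eventually_elim
        case (elim \<rho>)
        have "s < cmod (g (of_real \<rho> * cis t))" for t
          using elim a_bounds on_circle[of \<rho> t] by (intro q) auto
        with elim \<open>0 < s\<close> show ?case
          by (intro circle_mean_ge[OF outer]) (auto intro!: ln_mono simp: less_imp_le)
      qed
    qed simp
  qed
  \<comment> \<open>Let \<open>s\<close> tend to 1.\<close>
  then have "s \<le> exp c" if "0 < s" "s < 1" for s
    using that exp_le_cancel_iff[of "ln s" c] by simp
  then have "1 \<le> exp c" by (rule dense_le_bounded[OF zero_less_one])
  with \<open>c \<le> 0\<close> have c: "c = 0" by simp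
  have "0 \<le> n"
  proof -
    \<comment> \<open>Any radius between \<open>cmod a\<close> and 1 serves. The maximum of \<open>cmod (g z)\<close> on that circle is below
      1, so the mean is strictly negative; this rules out \<open>n = -1\<close>.\<close>
    define \<rho> where "\<rho> = (1 + cmod a) / 2"
    have \<rho>: "cmod a < \<rho>" "\<rho> < 1" "r < \<rho>" "0 < \<rho>"
      using a_bounds \<open>0 < r\<close> by (auto simp: \<rho>_def)
    have "continuous_on (sphere 0 \<rho>) (\<lambda>z. cmod (g z))"
      using hol \<rho> by (intro continuous_on_norm holomorphic_on_imp_continuous_on)
        (auto elim!: holomorphic_on_subset simp: annulus_def)
    then obtain z0 where z0: "z0 \<in> sphere 0 \<rho>" "\<And>z. z \<in> sphere 0 \<rho> \<Longrightarrow> cmod (g z) \<le> cmod (g z0)"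
      using continuous_attains_sup[of "sphere 0 \<rho>"] \<rho> by (metis compact_sphere less_imp_le sphere_eq_empty not_le)
    have z0': "z0 \<in> annulus r" "cmod z0 \<noteq> cmod a" using z0 \<rho> by (auto simp: annulus_def)
    have "ln (cmod (g (of_real \<rho> * cis t))) \<le> ln (cmod (g z0))" for t
      using \<rho> on_circle[of \<rho> t] g_pos by (intro ln_mono z0(2)) auto
    then have "(n + 1) * ln \<rho> \<le> ln (cmod (g z0))"
      using circle_mean_le[OF outer[OF \<rho>(1,2)]] c by simp
    also have "\<dots> < 0" using g_pos[OF z0'] g_lt1[OF z0'(1)] by simp
    finally have "0 < real_of_int (n + 1)" using \<rho> by (simp add: mult_less_0_iff)
    then show ?thesis by linarith
  qed
  \<comment> \<open>The minimum with 1 ensures that \<open>cball 0 s\<close> lies in the unit disc.\<close>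
  have below: "s \<le> cmod a" if "0 < s" "s < min y 1" for s
  proof -
    have "cball 0 s \<subseteq> ball 0 1 - E" using assms(4) that by fastforce
    then obtain q where q: "r < q" "\<And>z. z \<in> annulus r \<Longrightarrow> cmod z < q \<Longrightarrow> s < cmod (g z)"
      using norm_lower_bound_near_inner_circle[OF assms(8)] \<open>0 < r\<close> \<open>r < 1\<close> by (metis less_imp_le)
    obtain \<rho> where \<rho>: "r < \<rho>" "\<rho> < min q (cmod a)" using dense[of r "min q (cmod a)"] q a_bounds by auto
    have "s < cmod (g (of_real \<rho> * cis t))" for t
      using \<rho> a_bounds on_circle[of \<rho> t] by (intro q) auto
    then have "ln s \<le> n * ln \<rho> + c + ln (max \<rho> (cmod a))"
      using \<rho> a_bounds \<open>0 < s\<close> by (intro circle_mean_ge[OF mean]) (auto intro!: ln_mono simp: less_imp_le)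
    also have "\<dots> \<le> ln (cmod a)"
      using \<rho> c \<open>0 \<le> n\<close> a_bounds \<open>0 < r\<close> by (auto simp: max_def intro!: mult_nonneg_nonpos)
    finally show ?thesis using a_bounds(1) \<open>0 < r\<close> \<open>0 < s\<close> by (subst (asm) ln_le_cancel_iff) auto
  qed
  have "min y 1 \<le> cmod a"
    by (rule dense_le_bounded[of 0]) (use below \<open>y > 0\<close> in auto)
  with a_bounds show ?thesis by (simp add: a_def)
qed

end
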